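(* Let $(A,\cdot,\circ)$ be a skew brace such that $A = B\cdot C$ or $A = B\circ C$ for some sub-skew braces $B$ and $C$ satisfying both of the following: (1) $B$ and $C$ are trivial skew braces; (2) $B$ and $C$ are both left ideals and right ideals in the opposite skew brace $A^{\mathrm{op}}$. Then $A' = A*A$ is a trivial skew brace, i.e. $A$ is meta-trivial (equivalently $A'*A' = 1$).
   Context: A skew brace is a set $A$ with two group operations $\cdot$ (often written by juxtaposition) and $\circ$ such that $a\circ(bc) = (a\circ b)\,a^{-1}\,(a\circ c)$ for all $a,b,c\in A$. The two groups have the same identity $1$; $a^{-1}$ denotes the inverse of $a$ in $(A,\cdot)$ and $\overline{a}$ its inverse in $(A,\circ)$. Define $a*b = a^{-1}(a\circ b)b^{-1}$. For subsets $X,Y\subseteq A$, $X*Y$ denotes the subgroup of $(A,\cdot)$ generated by all $x*y$ with $x\in X$, $y\in Y$. A sub-skew brace is a subset that is a subgroup of both $(A,\cdot)$ and $(A,\circ)$. A skew brace (or sub-skew brace) $B$ is trivial if $a\circ b = ab$ for all $a,b\in B$. $A'=A*A$ (it is a sub-skew brace, in fact an ideal); $A$ is meta-trivial if $A'$ is a trivial skew brace. The opposite skew brace $A^{\mathrm{op}}$ is the set $A$ with operations $a\cdot^{\mathrm{op}} b = ba$ and the same $\circ$. Define $\lambda^{\mathrm{op}}_a(b) = (a\circ b)a^{-1}$. A subgroup $I$ of $(A,\cdot)$ is a left ideal in $A^{\mathrm{op}}$ iff $\lambda^{\mathrm{op}}_a(x)\in I$ for all $a\in A$, $x\in I$, and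 a right ideal in $A^{\mathrm{op}}$ iff $a^{-1}\lambda^{\mathrm{op}}_x(a)\in I$ for all $x\in I$, $a\in A$. *)

theory Defs
  imports "HOL-Algebra.Algebra"
begin

definition skew_brace :: "('a, 'm) monoid_scheme \<Rightarrow> ('a, 'n) monoid_scheme \<Rightarrow> bool" where
  "skew_brace G H \<longleftrightarrow> group G \<and> group H \<and> carrier H = carrier G \<and>
     (\<forall>a\<in>carrier G. \<forall>b\<in>carrier G. \<forall>c\<in>carrier G.
        a \<otimes>\<^bsub>H\<^esub> (b \<otimes>\<^bsub>G\<^esub> c)
          = (a \<otimes>\<^bsub>H\<^esub> b) \<otimes>\<^bsub>G\<^esub> inv\<^bsub>G\<^esub> a \<otimes>\<^bsub>G\<^esub> (a \<otimes>\<^bsub>H\<^esub> c))"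

definition bstar :: "('a, 'm) monoid_scheme \<Rightarrow> ('a, 'n) monoid_scheme \<Rightarrow> 'a \<Rightarrow> 'a \<Rightarrow> 'a" where
  "bstar G H a b = inv\<^bsub>G\<^esub> a \<otimes>\<^bsub>G\<^esub> (a \<otimes>\<^bsub>H\<^esub> b) \<otimes>\<^bsub>G\<^esub> inv\<^bsub>G\<^esub> b"

definition bstar_set :: "('a, 'm) monoid_scheme \<Rightarrow> ('a, 'n) monoid_scheme \<Rightarrow> 'a set \<Rightarrow> 'a set \<Rightarrow> 'a set" where
  "bstar_set G H S T = generate G {bstar G H s t | s t. s \<in> S \<and> t \<in> T}"

definition sub_skew_brace :: "('a, 'm) monoid_scheme \<Rightarrow> ('a, 'n) monoid_scheme \<Rightarrow> 'a set \<Rightarrow> bool" where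
  "sub_skew_brace G H S \<longleftrightarrow> subgroup S G \<and> subgroup S H"

definition trivial_on :: "('a, 'm) monoid_scheme \<Rightarrow> ('a, 'n) monoid_scheme \<Rightarrow> 'a set \<Rightarrow> bool" where
  "trivial_on G H S \<longleftrightarrow> (\<forall>a\<in>S. \<forall>b\<in>S. a \<otimes>\<^bsub>H\<^esub> b = a \<otimes>\<^bsub>G\<^esub> b)"

definition lambda_op :: "('a, 'm) monoid_scheme \<Rightarrow> ('a, 'n) monoid_scheme \<Rightarrow> 'a \<Rightarrow> 'a \<Rightarrow> 'a" where
  "lambda_op G H a b = (a \<otimes>\<^bsub>H\<^esub> b) \<otimes>\<^bsub>G\<^esub> inv\<^bsub>G\<^esub> a"

definition op_left_ideal :: "('a, 'm) monoid_scheme \<Rightarrow> ('a, 'n) monoid_scheme \<Rightarrow> 'a set \<Rightarrow> bool" where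
  "op_left_ideal G H I \<longleftrightarrow> subgroup I G \<and>
     (\<forall>a\<in>carrier G. \<forall>x\<in>I. lambda_op G H a x \<in> I)"

definition op_right_ideal :: "('a, 'm) monoid_scheme \<Rightarrow> ('a, 'n) monoid_scheme \<Rightarrow> 'a set \<Rightarrow> bool" where
  "op_right_ideal G H I \<longleftrightarrow> subgroup I G \<and>
     (\<forall>x\<in>I. \<forall>a\<in>carrier G. inv\<^bsub>G\<^esub> a \<otimes>\<^bsub>G\<^esub> lambda_op G H x a \<in> I)"

end

theory Submission
  imports Defs
begin

text \<open>
  Write \<open>lam a x = a\<inverse> (a \<circ> x)\<close>, an action of \<open>(A, \<circ>)\<close> on \<open>(A, \<cdot>)\<close>. One may assume
  \<open>A = B \<cdot> C = C \<cdot> B\<close>. The intersection \<open>D = B \<inter> C\<close> is normal, acts trivially under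
  \<open>lam\<close>, and \<open>b \<circ> c \<in> D c b\<close>, \<open>c \<circ> b \<in> D b c\<close>; hence \<open>lam\<close> reverses mixed products:
  \<open>lam (b c) x = lam c (lam b x)\<close> and \<open>lam (c b) x = lam b (lam c x)\<close>.

  As in the proof of Ito's theorem, comparing the two orders of action shows that \<open>lam b\<close> and
  \<open>lam c\<close> commute on the elements \<open>c\<^sub>1\<inverse> lam b\<^sub>1 c\<^sub>1\<close>, where the error terms come from
  commutators of \<open>B\<close>, all of whose \<open>C\<close>-conjugates stay in \<open>B\<close>. By symmetry and invariance
  they commute on all of \<open>A * A\<close>. On any subgroup where \<open>lam b\<close> and \<open>lam c\<close> commute, \<open>lam\<close>
  is also multiplicative for \<open>\<cdot>\<close>, so \<open>a * b = a\<inverse> (a \<circ> b) b\<inverse>\<close> acts trivially there.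
\<close>

section \<open>The action \<open>lam\<close> and its conjugated form
  \<open>lambda_op\<close>\<close>

locale skew_brace_pair = G: group G + H: group H
  for G :: "('a, 'm) monoid_scheme" (structure) and H :: "('a, 'n) monoid_scheme" +
  assumes carrier_H: "carrier H = carrier G"
    and brace: "\<lbrakk>a \<in> carrier G; b \<in> carrier G; c \<in> carrier G\<rbrakk> \<Longrightarrow>
      a \<otimes>\<^bsub>H\<^esub> (b \<otimes> c) = (a \<otimes>\<^bsub>H\<^esub> b) \<otimes> inv a \<otimes> (a \<otimes>\<^bsub>H\<^esub> c)"
begin

definition lam :: "'a \<Rightarrow> 'a \<Rightarrow> 'a" where
  "lam a x = inv a \<otimes> (a \<otimes>\<^bsub>H\<^esub> x)"

lemma inv_cancel [simp]:
  assumes "x \<in> carrier G" "y \<in> carrier G"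
  shows "x \<otimes> (inv x \<otimes> y) = y" "inv x \<otimes> (x \<otimes> y) = y"
  using assms by (simp_all flip: G.m_assoc)

lemma circ_closed [simp]: "\<lbrakk>a \<in> carrier G; b \<in> carrier G\<rbrakk> \<Longrightarrow> a \<otimes>\<^bsub>H\<^esub> b \<in> carrier G"
  using H.m_closed by (simp add: carrier_H)

lemma lam_closed [simp]: "\<lbrakk>a \<in> carrier G; x \<in> carrier G\<rbrakk> \<Longrightarrow> lam a x \<in> carrier G"
  by (simp add: lam_def)

lemma circ_eq: "\<lbrakk>a \<in> carrier G; x \<in> carrier G\<rbrakk> \<Longrightarrow> a \<otimes>\<^bsub>H\<^esub> x = a \<otimes> lam a x"
  by (simp add: lam_def)

lemma lam_mult:
  "\<lbrakk>a \<in> carrier G; x \<in> carrier G; y \<in> carrier G\<rbrakk> \<Longrightarrow> lam a (x \<otimes> y) = lam a x \<otimes> lam a y"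
  by (simp add: lam_def brace G.m_assoc)

lemma lam_one [simp]: "a \<in> carrier G \<Longrightarrow> lam a \<one> = \<one>"
  using lam_mult[of a \<one> \<one>] by simp

lemma lam_inv: "\<lbrakk>a \<in> carrier G; x \<in> carrier G\<rbrakk> \<Longrightarrow> lam a (inv x) = inv (lam a x)"
  using lam_mult[of a "inv x" x] by (simp add: G.inv_equality)

text \<open>Associativity of \<circ> makes \<open>lam (a \<circ> b) x\<close> the quotient of
  \<open>lam a (b \<circ> x)\<close> by \<open>lam a b\<close>; multiplicativity of
  \<open>lam a\<close> evaluates it.\<close>

lemma lam_circ:
  assumes "a \<in> carrier G" "b \<in> carrier G" "x \<in> carrier G"
  shows "lam (a \<otimes>\<^bsub>H\<^esub> b) x = lam a (lam b x)"
proof -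
  have "lam a (b \<otimes>\<^bsub>H\<^esub> x) = lam a b \<otimes> lam a (lam b x)"
    using assms by (simp add: circ_eq lam_mult)
  moreover have "lam (a \<otimes>\<^bsub>H\<^esub> b) x = inv (lam a b) \<otimes> lam a (b \<otimes>\<^bsub>H\<^esub> x)"
    using assms H.m_assoc[of a b x]
    by (simp add: lam_def carrier_H G.inv_mult_group G.m_assoc)
  ultimately show ?thesis
    using assms by simp
qed

text \<open>\<open>\<one>\<close> is idempotent for \<circ>, so it is also the identity of
  \<open>H\<close>.\<close>

lemma one_circ: "x \<in> carrier G \<Longrightarrow> \<one> \<otimes>\<^bsub>H\<^esub> x = x"
proof -
  assume x: "x \<in> carrier G"
  have "\<one> \<otimes>\<^bsub>H\<^esub> \<one> = \<one>"
    using circ_eq[of \<one> \<one>] by simp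
  then have "\<one> = \<one>\<^bsub>H\<^esub>"
    by (metis H.r_cancel_one' G.one_closed carrier_H)
  then show ?thesis
    using x carrier_H by simp
qed

lemma lam_one_left [simp]: "x \<in> carrier G \<Longrightarrow> lam \<one> x = x"
  by (simp add: lam_def one_circ)

lemma lambda_op_eq:
  "\<lbrakk>a \<in> carrier G; x \<in> carrier G\<rbrakk> \<Longrightarrow> lambda_op G H a x = a \<otimes> lam a x \<otimes> inv a"
  by (simp add: lambda_op_def circ_eq)

lemma lambda_op_mult:
  "\<lbrakk>a \<in> carrier G; x \<in> carrier G; y \<in> carrier G\<rbrakk> \<Longrightarrow>
    lambda_op G H a (x \<otimes> y) = lambda_op G H a x \<otimes> lambda_op G H a y"
  by (simp add: lambda_op_eq lam_mult G.m_assoc)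

lemma circ_eq_lambda_op:
  "\<lbrakk>a \<in> carrier G; x \<in> carrier G\<rbrakk> \<Longrightarrow> a \<otimes>\<^bsub>H\<^esub> x = lambda_op G H a x \<otimes> a"
  by (simp add: lambda_op_def G.m_assoc)

lemma lam_eq_lambda_op:
  "\<lbrakk>a \<in> carrier G; x \<in> carrier G\<rbrakk> \<Longrightarrow> lam a x = inv a \<otimes> lambda_op G H a x \<otimes> a"
  by (simp add: lambda_op_eq G.m_assoc)

lemma bstar_eq: "\<lbrakk>a \<in> carrier G; x \<in> carrier G\<rbrakk> \<Longrightarrow> bstar G H a x = lam a x \<otimes> inv x"
  by (simp add: bstar_def lam_def)

end

section \<open>The intersection of the factors and the reversal of mixed products\<close>

locale trivial_factorization = skew_brace_pair +
  fixes B C :: "'a set"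
  assumes subB: "subgroup B G" and subC: "subgroup C G"
    and factor: "carrier G = B <#> C"
    and trivB: "trivial_on G H B" and trivC: "trivial_on G H C"
    and leftB: "op_left_ideal G H B" and leftC: "op_left_ideal G H C"
    and rightB: "op_right_ideal G H B" and rightC: "op_right_ideal G H C"
begin

lemma B_carrier [simp]: "b \<in> B \<Longrightarrow> b \<in> carrier G"
  using subB subgroup.subset by blast

lemma C_carrier [simp]: "c \<in> C \<Longrightarrow> c \<in> carrier G"
  using subC subgroup.subset by blast

lemmas B_rules [simp] = subgroup.m_closed[OF subB] subgroup.m_inv_closed[OF subB]
lemmas C_rules [simp] = subgroup.m_closed[OF subC] subgroup.m_inv_closed[OF subC]

lemma factor_BC:
  assumes "x \<in> carrier G"
  obtains b c where "b \<in> B" "c \<in> C" "x = b \<otimes> c"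
  using assms factor by (auto simp: set_mult_def)

lemma factor_CB:
  assumes "x \<in> carrier G"
  obtains b c where "b \<in> B" "c \<in> C" "x = c \<otimes> b"
proof -
  obtain b c where bc: "b \<in> B" "c \<in> C" "inv x = b \<otimes> c"
    using assms factor_BC[of "inv x"] by auto
  then have "x = inv c \<otimes> inv b"
    using assms by (metis B_carrier C_carrier G.inv_inv G.inv_mult_group)
  then show thesis
    using that[of "inv b" "inv c"] bc by simp
qed

lemma lam_BB [simp]: "\<lbrakk>b \<in> B; b' \<in> B\<rbrakk> \<Longrightarrow> lam b b' = b'"
  using trivB by (simp add: lam_def trivial_on_def)

lemma lam_CC [simp]: "\<lbrakk>c \<in> C; c' \<in> C\<rbrakk> \<Longrightarrow> lam c c' = c'"
  using trivC by (simp add: lam_def trivial_on_def)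

lemma lambda_op_B: "\<lbrakk>x \<in> carrier G; b \<in> B\<rbrakk> \<Longrightarrow> lambda_op G H x b \<in> B"
  using leftB by (simp add: op_left_ideal_def)

lemma lambda_op_C: "\<lbrakk>x \<in> carrier G; c \<in> C\<rbrakk> \<Longrightarrow> lambda_op G H x c \<in> C"
  using leftC by (simp add: op_left_ideal_def)

text \<open>The quotient lies in \<open>B\<close> because \<open>B\<close> is a right ideal of the
  opposite brace, and in \<open>C\<close> because \<open>C\<close> is a left ideal.\<close>

lemma lambda_op_BC:
  assumes "b \<in> B" "c \<in> C"
  obtains d where "d \<in> B \<inter> C" "lambda_op G H b c = c \<otimes> d"
proof
  show "inv c \<otimes> lambda_op G H b c \<in> B \<inter> C"
    using assms rightB lambda_op_C[of b c] by (simp add: op_right_ideal_def)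
  show "lambda_op G H b c = c \<otimes> (inv c \<otimes> lambda_op G H b c)"
    using assms lambda_op_C[of b c] by simp
qed

text \<open>The hypotheses are symmetric in the factors, so every fact proved for one has a mirror
  image for the other.\<close>

lemma swap: "trivial_factorization G H C B"
proof -
  have "carrier G = C <#> B"
  proof
    show "carrier G \<subseteq> C <#> B"
      by (rule subsetI, erule factor_CB) (auto simp: set_mult_def)
  qed (auto simp: set_mult_def)
  then show ?thesis
    by (intro trivial_factorization.intro skew_brace_pair_axioms trivial_factorization_axioms.intro
        subB subC trivB trivC leftB leftC rightB rightC)
qed

text \<open>An element of \<open>B\<close> or of \<open>C\<close> fixes the intersection under
  \<open>lam\<close>, so there \<open>lambda_op\<close> is plain conjugation, which both left ideals
  absorb.\<close>

lemma D_normal: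
  assumes "x \<in> carrier G" "d \<in> B \<inter> C"
  shows "x \<otimes> d \<otimes> inv x \<in> B \<inter> C"
proof -
  have b: "b \<otimes> e \<otimes> inv b \<in> B \<inter> C" if "b \<in> B" "e \<in> B \<inter> C" for b e
    using that lambda_op_B[of b e] lambda_op_C[of b e] by (simp add: lambda_op_eq)
  have c: "c \<otimes> e \<otimes> inv c \<in> B \<inter> C" if "c \<in> C" "e \<in> B \<inter> C" for c e
    using that lambda_op_B[of c e] lambda_op_C[of c e] by (simp add: lambda_op_eq)
  obtain b' c' where "b' \<in> B" "c' \<in> C" "x = b' \<otimes> c'"
    using assms factor_BC by blast
  moreover from this have "b' \<otimes> (c' \<otimes> d \<otimes> inv c') \<otimes> inv b' \<in> B \<inter> C"
    using b c assms by blast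
  ultimately show ?thesis
    using assms by (simp add: G.m_assoc G.inv_mult_group del: B_rules C_rules)
qed

lemma D_commute:
  assumes "x \<in> carrier G" "d \<in> B \<inter> C"
  obtains d' where "d' \<in> B \<inter> C" "x \<otimes> d = d' \<otimes> x"
  using D_normal[OF assms] that[of "x \<otimes> d \<otimes> inv x"] assms by (auto simp: G.m_assoc)

text \<open>By triviality of both factors, \<open>d\<close> fixes \<open>B\<close> and
  \<open>C\<close>, which generate everything.\<close>

lemma lam_D:
  assumes "d \<in> B \<inter> C" "x \<in> carrier G"
  shows "lam d x = x"
proof -
  obtain b c where "b \<in> B" "c \<in> C" "x = b \<otimes> c"
    using assms factor_BC by blast
  then show ?thesis
    using assms by (simp add: lam_mult)
qed

lemma lam_D_mult:
  assumes "d \<in> B \<inter> C" "y \<in> carrier G" "x \<in> carrier G"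
  shows "lam (d \<otimes> y) x = lam y x"
proof -
  have "d \<otimes> y = d \<otimes>\<^bsub>H\<^esub> y"
    using assms by (simp add: circ_eq lam_D)
  then show ?thesis
    using assms by (simp add: lam_circ lam_D)
qed

text \<open>Modulo the intersection, which acts trivially, \<open>b \<circ> c\<close> is
  \<open>c \<otimes> b\<close>.\<close>

lemma lam_CB:
  assumes "b \<in> B" "c \<in> C" "x \<in> carrier G"
  shows "lam (c \<otimes> b) x = lam b (lam c x)"
proof -
  obtain d where d: "d \<in> B \<inter> C" "lambda_op G H b c = c \<otimes> d"
    using assms lambda_op_BC by blast
  obtain e where e: "e \<in> B \<inter> C" "c \<otimes> d = e \<otimes> c"
    using d assms D_commute[of c d] by auto
  have "b \<otimes>\<^bsub>H\<^esub> c = e \<otimes> (c \<otimes> b)"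
    using assms d e by (simp add: circ_eq_lambda_op G.m_assoc)
  then show ?thesis
    using assms e lam_circ[of b c x] lam_D_mult[of e "c \<otimes> b" x] by simp
qed

lemma lam_BC:
  assumes "b \<in> B" "c \<in> C" "x \<in> carrier G"
  shows "lam (b \<otimes> c) x = lam c (lam b x)"
  using trivial_factorization.lam_CB[OF swap] assms by blast

lemma lam_B_mult:
  assumes "b \<in> B" "b' \<in> B" "x \<in> carrier G"
  shows "lam (b \<otimes> b') x = lam b (lam b' x)"
  using assms lam_circ[of b b' x] by (simp add: circ_eq)

lemma lam_C_mult:
  assumes "c \<in> C" "c' \<in> C" "x \<in> carrier G"
  shows "lam (c \<otimes> c') x = lam c (lam c' x)"
  using assms lam_circ[of c c' x] by (simp add: circ_eq)

lemma lam_B_inv [simp]: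
  assumes "b \<in> B" "x \<in> carrier G"
  shows "lam b (lam (inv b) x) = x" "lam (inv b) (lam b x) = x"
  using assms lam_B_mult[of b "inv b" x] lam_B_mult[of "inv b" b x] by simp_all

text \<open>The map \<open>lambda_op G H (inv b\<^sub>1)\<close> is conjugation by \<open>inv b\<^sub>1\<close> on \<open>B\<close> and the identity
  modulo \<open>B \<inter> C\<close> on \<open>C\<close>, so an exchange relation \<open>b c = c' b'\<close> survives conjugating
  \<open>b\<close> and \<open>b'\<close> simultaneously.\<close>

lemma exchange_conj:
  assumes "b \<in> B" "b' \<in> B" "c \<in> C" "c' \<in> C" "b1 \<in> B" and eq: "b \<otimes> c = c' \<otimes> b'"
  obtains d where "d \<in> B \<inter> C"
    "(inv b1 \<otimes> b \<otimes> b1) \<otimes> c = d \<otimes> (c' \<otimes> (inv b1 \<otimes> b' \<otimes> b1))"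
proof -
  let ?m = "lambda_op G H (inv b1)"
  obtain d where d: "d \<in> B \<inter> C" "?m c = c \<otimes> d"
    using assms lambda_op_BC[of "inv b1" c] by auto
  obtain d' where d': "d' \<in> B \<inter> C" "?m c' = c' \<otimes> d'"
    using assms lambda_op_BC[of "inv b1" c'] by auto
  let ?x = "inv b1 \<otimes> b \<otimes> b1" and ?x' = "inv b1 \<otimes> b' \<otimes> b1"
  have x: "?x \<in> B" "?x' \<in> B" using assms by simp_all
  have "?m (b \<otimes> c) = ?x \<otimes> (c \<otimes> d)" "?m (c' \<otimes> b') = c' \<otimes> d' \<otimes> ?x'"
    using assms(1-5) d d' by (simp_all add: lambda_op_mult) (simp_all add: lambda_op_eq)
  then have 1: "?x \<otimes> c \<otimes> d = c' \<otimes> d' \<otimes> ?x'"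
    using eq assms d x by (simp add: G.m_assoc)
  obtain e' where e': "e' \<in> B \<inter> C" "c' \<otimes> d' = e' \<otimes> c'"
    using D_commute[of c' d'] assms d' by auto
  obtain e where e: "e \<in> B \<inter> C" "(?x \<otimes> c) \<otimes> d = e \<otimes> (?x \<otimes> c)"
  proof (rule D_commute[OF _ d(1)])
    show "?x \<otimes> c \<in> carrier G"
      using assms(3) x(1) by simp
  qed
  have "e \<otimes> (?x \<otimes> c) = e' \<otimes> (c' \<otimes> ?x')"
    unfolding e(2)[symmetric] 1 e'(2) using e'(1) x(2) assms(4) by (simp add: G.m_assoc)
  then have "inv e \<otimes> (e \<otimes> (?x \<otimes> c)) = inv e \<otimes> (e' \<otimes> (c' \<otimes> ?x'))"
    by simp
  then have "?x \<otimes> c = (inv e \<otimes> e') \<otimes> (c' \<otimes> ?x')"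
    using e(1) e'(1) x assms(1-5) by (simp add: G.m_assoc)
  then show thesis
    using that[of "inv e \<otimes> e'"] e e' by simp
qed

section \<open>Commutators of \<open>B\<close> and exchange relations\<close>

text \<open>The group commutator, bracketed as the quotient of \<open>b\<close> by its conjugate so
  that \<open>exchange_conj\<close> applies.\<close>

definition comm :: "'a \<Rightarrow> 'a \<Rightarrow> 'a" where
  "comm b1 b = inv (inv b1 \<otimes> b \<otimes> b1) \<otimes> b"

lemma comm_closed [simp]: "\<lbrakk>b1 \<in> B; b \<in> B\<rbrakk> \<Longrightarrow> comm b1 b \<in> B"
  by (simp add: comm_def)

lemma comm_swap: "\<lbrakk>b1 \<in> B; b \<in> B\<rbrakk> \<Longrightarrow> b \<otimes> (b1 \<otimes> comm b1 b) = b1 \<otimes> b"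
  by (simp add: comm_def G.m_assoc G.inv_mult_group)

text \<open>Dividing the relation \<open>b c = c' b'\<close> by its conjugated version cancels
  \<open>c'\<close> up to an element of the normal subgroup \<open>B \<inter> C\<close>; what
  remains lies in \<open>B\<close>.\<close>

lemma comm_conj:
  assumes "b1 \<in> B" "b \<in> B" "c \<in> C"
  shows "inv c \<otimes> comm b1 b \<otimes> c \<in> B"
proof -
  obtain b' c' where bc: "b' \<in> B" "c' \<in> C" "b \<otimes> c = c' \<otimes> b'"
    using factor_CB[of "b \<otimes> c"] assms by auto
  obtain d where d: "d \<in> B \<inter> C"
    "(inv b1 \<otimes> b \<otimes> b1) \<otimes> c = d \<otimes> (c' \<otimes> (inv b1 \<otimes> b' \<otimes> b1))"
    using exchange_conj[of b b' c c' b1] assms bc by auto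
  have e: "inv c' \<otimes> inv d \<otimes> c' \<in> B"
    using D_normal[of "inv c'" "inv d"] d bc by simp
  have "inv c \<otimes> comm b1 b \<otimes> c = inv ((inv b1 \<otimes> b \<otimes> b1) \<otimes> c) \<otimes> (b \<otimes> c)"
    using assms by (simp add: comm_def G.m_assoc G.inv_mult_group)
  also have "\<dots> = inv (d \<otimes> (c' \<otimes> (inv b1 \<otimes> b' \<otimes> b1))) \<otimes> (c' \<otimes> b')"
    by (simp add: d bc)
  also have "\<dots> = inv (inv b1 \<otimes> b' \<otimes> b1) \<otimes> (inv c' \<otimes> inv d \<otimes> c') \<otimes> b'"
    using assms bc d by (simp add: G.m_assoc G.inv_mult_group)
  also have "\<dots> \<in> B"
    using e assms bc by simp
  finally show ?thesis .
qed

lemma lam_exchange: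
  assumes "b \<in> B" "b' \<in> B" "c \<in> C" "c' \<in> C" "b \<otimes> c = c' \<otimes> b'" "x \<in> carrier G"
  shows "lam c (lam b x) = lam b' (lam c' x)"
  using assms lam_BC[of b c x] lam_CB[of b' c' x] by simp

text \<open>\<open>b\<close> and its conjugate satisfy exchange relations with the same
  \<open>c\<close> and \<open>c'\<close>; comparing the two gives the relation for the
  quotients.\<close>

lemma lam_comm_exchange:
  assumes "b \<in> B" "b' \<in> B" "c \<in> C" "c' \<in> C" "b1 \<in> B" "x \<in> carrier G"
    and eq: "b \<otimes> c = c' \<otimes> b'"
  shows "lam (comm b1 b') (lam c' x) = lam c' (lam (comm b1 b) x)"
proof -
  let ?y = "inv b1 \<otimes> b \<otimes> b1" and ?y' = "inv b1 \<otimes> b' \<otimes> b1"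
  have y: "?y \<in> B" "?y' \<in> B" using assms by simp_all
  obtain d where d: "d \<in> B \<inter> C" "?y \<otimes> c = d \<otimes> (c' \<otimes> ?y')"
    using exchange_conj[of b b' c c' b1] assms by auto
  have ex: "lam c (lam ?y z) = lam ?y' (lam c' z)" if "z \<in> carrier G" for z
    using that d assms y lam_BC[of ?y c z] lam_CB[of ?y' c' z]
      lam_D_mult[of d "c' \<otimes> ?y'" z] by simp
  have "lam ?y' (lam c' (lam (comm b1 b) x)) = lam c (lam ?y (lam (comm b1 b) x))"
    using ex assms by simp
  also have "\<dots> = lam c (lam b x)"
  proof -
    have "?y \<otimes> comm b1 b = b"
      using y assms by (simp only: comm_def) simp
    then show ?thesis
      using lam_B_mult[of ?y "comm b1 b" x] assms y by simp
  qed
  also have "\<dots> = lam b' (lam c' x)"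
    using lam_exchange assms by blast
  also have "\<dots> = lam ?y' (lam (comm b1 b') (lam c' x))"
  proof -
    have "?y' \<otimes> comm b1 b' = b'"
      using y assms by (simp only: comm_def) simp
    then show ?thesis
      using lam_B_mult[of ?y' "comm b1 b'" "lam c' x"] assms y by simp
  qed
  finally have "lam (inv ?y') (lam ?y' (lam c' (lam (comm b1 b) x)))
      = lam (inv ?y') (lam ?y' (lam (comm b1 b') (lam c' x)))"
    by simp
  then show ?thesis
    using y(2) assms by (simp only: lam_B_inv lam_closed comm_closed B_carrier C_carrier)
qed

section \<open>Commuting mixed actions on the elements \<open>dev b c\<close>\<close>

text \<open>Up to inversion a star product: \<open>dev b (inv c)\<close> is the inverse of
  \<open>bstar G H b c\<close>.\<close>

definition dev :: "'a \<Rightarrow> 'a \<Rightarrow> 'a" where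
  "dev b c = inv c \<otimes> lam b c"

lemma dev_closed [simp]: "\<lbrakk>b \<in> carrier G; c \<in> carrier G\<rbrakk> \<Longrightarrow> dev b c \<in> carrier G"
  by (simp add: dev_def)

lemma dev_comm_in_B:
  assumes "b1 \<in> B" "b \<in> B" "c \<in> C"
  shows "dev (comm b1 b) c \<in> B"
proof -
  let ?k = "comm b1 b"
  have k: "?k \<in> B" using assms by simp
  obtain d where d: "d \<in> B \<inter> C" "lambda_op G H ?k c = c \<otimes> d"
    using lambda_op_BC k assms by blast
  have "dev ?k c = inv (inv c \<otimes> ?k \<otimes> c) \<otimes> d \<otimes> ?k"
    using assms d k by (simp add: dev_def lam_eq_lambda_op G.m_assoc G.inv_mult_group)
  also have "\<dots> \<in> B"
    using comm_conj[OF assms] d k by simp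
  finally show ?thesis .
qed

text \<open>Both \<open>c1\<close> and \<open>c'\<close> fix \<open>c\<close>, so only
  \<open>b\<close> changes.\<close>

lemma lam_C_dev:
  assumes "b \<in> B" "b' \<in> B" "c \<in> C" "c1 \<in> C" "c' \<in> C" "b \<otimes> c1 = c' \<otimes> b'"
  shows "lam c1 (dev b c) = dev b' c"
  using assms lam_exchange[of b b' c1 c' c] by (simp add: dev_def lam_mult lam_inv)

text \<open>Moving \<open>b1\<close> past \<open>b\<close> costs the commutator, whose deviation
  lies in \<open>B\<close> and is fixed by \<open>b\<close> and \<open>b1\<close>. The factor
  \<open>\<beta>\<close> is fixed by \<open>b\<close> and cancels, so only \<open>c\<close> changes,
  up to that error term.\<close>

lemma lam_B_dev:
  assumes "b \<in> B" "b1 \<in> B" "c \<in> C" "c3 \<in> C" "\<beta> \<in> B" and eq: "lam b1 c = \<beta> \<otimes> c3"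
  shows "lam b1 (dev b c) = dev b c3 \<otimes> dev (comm b1 b) c"
proof -
  let ?k = "comm b1 b"
  have k: "?k \<in> B" using assms by simp
  have g: "dev ?k c \<in> B" using dev_comm_in_B assms by simp
  have "lam b1 (lam b c) = lam (b \<otimes> (b1 \<otimes> ?k)) c"
    using assms by (simp add: comm_swap lam_B_mult)
  also have "\<dots> = lam b (lam b1 (lam ?k c))"
    using assms k by (simp add: lam_B_mult)
  also have "lam ?k c = c \<otimes> dev ?k c"
    using assms k by (simp add: dev_def)
  also have "lam b (lam b1 (c \<otimes> dev ?k c)) = lam b (lam b1 c) \<otimes> dev ?k c"
    using assms g by (simp add: lam_mult)
  also have "lam b (lam b1 c) = \<beta> \<otimes> lam b c3"
    using assms by (simp add: lam_mult)
  finally show ?thesis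
    using assms g by (simp add: dev_def[of b] lam_mult lam_inv G.m_assoc G.inv_mult_group)
qed

text \<open>The two orders yield the same main term \<open>dev b' c3\<close>; it remains to match
  the error terms.\<close>

lemma lam_commute_dev:
  assumes "b1 \<in> B" "c1 \<in> C" "b \<in> B" "c \<in> C"
  shows "lam b1 (lam c1 (dev b c)) = lam c1 (lam b1 (dev b c))"
proof -
  obtain b' c' where bc: "b' \<in> B" "c' \<in> C" "b \<otimes> c1 = c' \<otimes> b'"
    using factor_CB[of "b \<otimes> c1"] assms by auto
  obtain \<beta> c3 where c3: "\<beta> \<in> B" "c3 \<in> C" "lam b1 c = \<beta> \<otimes> c3"
    using factor_BC[of "lam b1 c"] assms by auto
  let ?k = "dev (comm b1 b) c" and ?k' = "dev (comm b1 b') c"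
  have k: "?k \<in> B" "?k' \<in> B" using dev_comm_in_B assms bc by simp_all
  have k': "?k' = lam c' ?k"
    using lam_comm_exchange[of b b' c1 c' b1 c] assms bc
    by (simp add: dev_def lam_mult lam_inv)
  \<comment> \<open>Since \<open>b\<close> fixes \<open>?k\<close>, its action can be inserted to
    make the exchange relation applicable; \<open>b'\<close> then fixes the result
    \<open>?k'\<close>.\<close>
  have "lam c1 ?k = lam c1 (lam b ?k)"
    using k assms by simp
  also have "\<dots> = lam b' (lam c' ?k)"
    using lam_exchange[of b b' c1 c' ?k] assms bc k by simp
  also have "\<dots> = ?k'"
    using k bc by (simp flip: k')
  finally have c1k: "lam c1 ?k = ?k'" .
  have "lam b1 (lam c1 (dev b c)) = dev b' c3 \<otimes> ?k'"
    using lam_C_dev[of b b' c c1 c'] lam_B_dev[of b' b1 c c3 \<beta>] assms bc c3 by simp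
  moreover have "lam c1 (lam b1 (dev b c)) = dev b' c3 \<otimes> ?k'"
    using lam_C_dev[of b b' c3 c1 c'] lam_B_dev[of b b1 c c3 \<beta>] assms bc c3 k
    by (simp add: lam_mult c1k)
  ultimately show ?thesis by simp
qed

section \<open>The invariant subgroup where mixed actions commute\<close>

definition commuting_part :: "'a set" where
  "commuting_part = {y \<in> carrier G. \<forall>b\<in>B. \<forall>c\<in>C. lam b (lam c y) = lam c (lam b y)}"

lemma commuting_part_carrier [simp]: "y \<in> commuting_part \<Longrightarrow> y \<in> carrier G"
  by (simp add: commuting_part_def)

lemma commuting_partI:
  "\<lbrakk>y \<in> carrier G; \<And>b c. \<lbrakk>b \<in> B; c \<in> C\<rbrakk> \<Longrightarrow> lam c (lam b y) = lam b (lam c y)\<rbrakk>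
    \<Longrightarrow> y \<in> commuting_part"
  unfolding commuting_part_def by (intro CollectI conjI ballI; simp only:)

lemma commuting_partD:
  "\<lbrakk>y \<in> commuting_part; b \<in> B; c \<in> C\<rbrakk> \<Longrightarrow> lam c (lam b y) = lam b (lam c y)"
  unfolding commuting_part_def by (rule sym) blast

lemma subgroup_commuting_part: "subgroup commuting_part G"
proof
  show "commuting_part \<subseteq> carrier G"
    by auto
  show "\<one> \<in> commuting_part"
    by (rule commuting_partI) simp_all
  show "x \<otimes> y \<in> commuting_part" if "x \<in> commuting_part" "y \<in> commuting_part" for x y
    using that commuting_partD[OF that(1)] commuting_partD[OF that(2)]
    by (intro commuting_partI) (simp_all add: lam_mult)
  show "inv x \<in> commuting_part" if "x \<in> commuting_part" for x
    using that commuting_partD[OF that] by (intro commuting_partI) (simp_all add: lam_inv)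
qed

text \<open>Composing two actions from \<open>B\<close> is again an action from \<open>B\<close>, so
  the commutation with \<open>c\<close> can be used for the product
  \<open>b' \<otimes> b\<close>.\<close>

lemma lam_B_commuting_part:
  assumes "b \<in> B" "y \<in> commuting_part"
  shows "lam b y \<in> commuting_part"
proof -
  have "lam c (lam b' (lam b y)) = lam b' (lam c (lam b y))" if "b' \<in> B" "c \<in> C" for b' c
  proof -
    have "lam c (lam (b' \<otimes> b) y) = lam (b' \<otimes> b) (lam c y)"
      using that assms by (intro commuting_partD) simp_all
    then show ?thesis
      using that assms by (simp add: lam_B_mult commuting_partD)
  qed
  then show ?thesis
    using assms by (intro commuting_partI) simp_all
qed

lemma commuting_part_swap:
  "trivial_factorization.commuting_part G H C B = commuting_part"
  unfolding commuting_part_def trivial_factorization.commuting_part_def[OF swap]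
  by (intro Collect_cong conj_cong refl iffI ballI; rule sym; blast)

lemma lam_C_commuting_part:
  "\<lbrakk>c \<in> C; y \<in> commuting_part\<rbrakk> \<Longrightarrow> lam c y \<in> commuting_part"
  using trivial_factorization.lam_B_commuting_part[OF swap] commuting_part_swap by simp

lemma bstar_B_commuting_part:
  assumes "b \<in> B" "x \<in> carrier G"
  shows "bstar G H b x \<in> commuting_part"
proof -
  \<comment> \<open>With the \<open>B\<close> factor on the right, \<open>b\<close> fixes it and it
    cancels from the star product.\<close>
  obtain b' c where bc: "b' \<in> B" "c \<in> C" "x = c \<otimes> b'"
    by (rule factor_CB[OF assms(2)])
  have "bstar G H b x = inv (dev b (inv c))"
    using assms bc
    by (simp add: bstar_eq dev_def lam_mult lam_inv G.m_assoc G.inv_mult_group)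
  moreover have "dev b (inv c) \<in> commuting_part"
    using assms bc by (intro commuting_partI) (simp_all add: lam_commute_dev[symmetric])
  ultimately show ?thesis
    using subgroup.m_inv_closed[OF subgroup_commuting_part] by simp
qed

lemma bstar_C_commuting_part:
  "\<lbrakk>c \<in> C; x \<in> carrier G\<rbrakk> \<Longrightarrow> bstar G H c x \<in> commuting_part"
  using trivial_factorization.bstar_B_commuting_part[OF swap] commuting_part_swap by simp

text \<open>A cocycle identity splits the star product along \<open>a = b \<otimes> c\<close> into
  the two known cases.\<close>

lemma bstar_commuting_part:
  assumes "a \<in> carrier G" "x \<in> carrier G"
  shows "bstar G H a x \<in> commuting_part"
proof -
  obtain b c where bc: "b \<in> B" "c \<in> C" "a = b \<otimes> c"
    by (rule factor_BC[OF assms(1)])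
  have "bstar G H a x = lam c (bstar G H b x) \<otimes> bstar G H c x"
    using assms bc by (simp add: bstar_eq lam_BC lam_mult lam_inv G.m_assoc)
  then show ?thesis
    using subgroup.m_closed[OF subgroup_commuting_part] bc assms lam_C_commuting_part
      bstar_B_commuting_part bstar_C_commuting_part by simp
qed

lemma lam_commuting_part:
  assumes "a \<in> carrier G" "y \<in> commuting_part"
  shows "lam a y \<in> commuting_part"
proof -
  obtain b c where "b \<in> B" "c \<in> C" "a = b \<otimes> c"
    by (rule factor_BC[OF assms(1)])
  then show ?thesis
    using assms(2) by (simp add: lam_BC lam_B_commuting_part lam_C_commuting_part)
qed

section \<open>Multiplicativity of \<open>lam\<close> and triviality of the derived brace\<close>

text \<open>Once mixed actions commute, the reversal in \<open>lam_BC\<close> is harmless; rewriting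
  \<open>c b'\<close> as \<open>b2 c2\<close> sorts the product into \<open>B\<close> and
  \<open>C\<close> parts.\<close>

lemma lam_hom_commuting_part:
  assumes "x \<in> carrier G" "x' \<in> carrier G" "y \<in> commuting_part"
  shows "lam (x \<otimes> x') y = lam x (lam x' y)"
proof -
  obtain b c where bc: "b \<in> B" "c \<in> C" "x = b \<otimes> c"
    by (rule factor_BC[OF assms(1)])
  obtain b' c' where bc': "b' \<in> B" "c' \<in> C" "x' = b' \<otimes> c'"
    by (rule factor_BC[OF assms(2)])
  obtain b2 c2 where bc2: "b2 \<in> B" "c2 \<in> C" "c \<otimes> b' = b2 \<otimes> c2"
    using factor_BC[of "c \<otimes> b'"] bc bc' by auto
  note [simp] = bc(1,2) bc'(1,2) bc2(1,2) lam_B_commuting_part lam_C_commuting_part assms(3)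
  have ex: "lam c2 (lam b2 z) = lam b' (lam c z)" if "z \<in> carrier G" for z
    using lam_exchange[of b2 b' c2 c z] bc2(3) that by simp
  have "x \<otimes> x' = b \<otimes> (c \<otimes> b') \<otimes> c'"
    by (simp add: bc(3) bc'(3) G.m_assoc)
  also have "\<dots> = (b \<otimes> b2) \<otimes> (c2 \<otimes> c')"
    by (simp add: bc2(3) G.m_assoc)
  finally have "lam (x \<otimes> x') y = lam c2 (lam c' (lam b (lam b2 y)))"
    by (simp add: lam_BC lam_B_mult lam_C_mult)
  also have "\<dots> = lam b (lam c2 (lam b2 (lam c' y)))"
    by (simp add: commuting_partD)
  also have "\<dots> = lam b (lam b' (lam c (lam c' y)))"
    by (simp add: ex)
  also have "\<dots> = lam x (lam x' y)"
    by (simp add: bc(3) bc'(3) lam_BC commuting_partD)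
  finally show ?thesis .
qed

text \<open>Here \<open>lam\<close> turns both products into composition, so the factors of
  \<open>bstar\<close> cancel in pairs.\<close>

lemma lam_bstar_commuting_part:
  assumes "a \<in> carrier G" "b \<in> carrier G" "y \<in> commuting_part"
  shows "lam (bstar G H a b) y = y"
proof -
  note [simp] = assms lam_commuting_part
  have "lam (bstar G H a b) y = lam (inv a) (lam a (lam b (lam (inv b) y)))"
    by (simp add: bstar_def lam_hom_commuting_part lam_circ)
  also have "\<dots> = y"
    using lam_hom_commuting_part[of b "inv b" y] lam_hom_commuting_part[of "inv a" a y] by simp
  finally show ?thesis .
qed

theorem derived_trivial: "trivial_on G H (bstar_set G H (carrier G) (carrier G))"
proof -
  let ?S = "{bstar G H s t | s t. s \<in> carrier G \<and> t \<in> carrier G}"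
  \<comment> \<open>The kernel of the action on \<open>commuting_part\<close>; the derived brace
    lies in both, so it acts trivially on itself.\<close>
  let ?K = "{x \<in> carrier G. \<forall>y\<in>commuting_part. lam x y = y}"
  have M: "generate G ?S \<subseteq> commuting_part"
    using bstar_commuting_part by (intro G.generate_subgroup_incl subgroup_commuting_part) auto
  have K_inv: "lam (inv x) y = y" if "x \<in> ?K" "y \<in> commuting_part" for x y
    using that lam_hom_commuting_part[of "inv x" x y] by simp
  have "subgroup ?K G"
    by standard (use K_inv in \<open>auto simp: lam_hom_commuting_part\<close>)
  moreover have "?S \<subseteq> ?K"
    using lam_bstar_commuting_part bstar_commuting_part by auto
  ultimately have K: "generate G ?S \<subseteq> ?K"
    by (intro G.generate_subgroup_incl)
  have "x \<otimes>\<^bsub>H\<^esub> y = x \<otimes> y" if "x \<in> generate G ?S" "y \<in> generate G ?S" for x y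
  proof -
    have "x \<in> carrier G" "y \<in> carrier G" "lam x y = y"
      using that M K by (blast intro: commuting_part_carrier)+
    then show ?thesis
      using circ_eq[of x y] by simp
  qed
  then show ?thesis
    unfolding trivial_on_def bstar_set_def by blast
qed

end

theorem theorem1p5:
  fixes G :: "('a, 'm) monoid_scheme" and H :: "('a, 'n) monoid_scheme"
    and B C :: "'a set"
  assumes "skew_brace G H"
    and "sub_skew_brace G H B" and "sub_skew_brace G H C"
    and "carrier G = B <#>\<^bsub>G\<^esub> C \<or> carrier G = B <#>\<^bsub>H\<^esub> C"
    and "trivial_on G H B" and "trivial_on G H C"
    and "op_left_ideal G H B" and "op_right_ideal G H B"
    and "op_left_ideal G H C" and "op_right_ideal G H C"
  shows "trivial_on G H (bstar_set G H (carrier G) (carrier G))"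
proof -
  interpret skew_brace_pair G H
    using assms(1) by (simp add: skew_brace_def skew_brace_pair_def skew_brace_pair_axioms_def)
  have sub: "subgroup B G" "subgroup C G"
    using assms(2,3) by (simp_all add: sub_skew_brace_def)
  show ?thesis
  proof (cases "carrier G = B <#>\<^bsub>G\<^esub> C")
    case True
    then interpret trivial_factorization G H B C
      using assms sub skew_brace_pair_axioms
      by (intro trivial_factorization.intro trivial_factorization_axioms.intro)
    show ?thesis by (rule derived_trivial)
  next
    case False
    then have circ: "carrier G = B <#>\<^bsub>H\<^esub> C"
      using assms(4) by simp
    \<comment> \<open>The left ideal property of \<open>C\<close> rewrites
      \<open>b \<circ> c\<close> as an element of \<open>C\<close> times \<open>b\<close>, giving a
      factorization in \<open>G\<close> with the factors exchanged.\<close>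
    have "carrier G \<subseteq> C <#>\<^bsub>G\<^esub> B"
    proof
      fix x assume "x \<in> carrier G"
      then obtain b c where bc: "b \<in> B" "c \<in> C" "x = b \<otimes>\<^bsub>H\<^esub> c"
        using circ by (auto simp: set_mult_def)
      moreover have "b \<in> carrier G" "c \<in> carrier G"
        using bc sub subgroup.subset by blast+
      ultimately have "x = lambda_op G H b c \<otimes>\<^bsub>G\<^esub> b" "lambda_op G H b c \<in> C"
        using assms(9) by (simp_all add: circ_eq_lambda_op op_left_ideal_def)
      then show "x \<in> C <#>\<^bsub>G\<^esub> B"
        using bc by (auto simp: set_mult_def)
    qed
    moreover have "C <#>\<^bsub>G\<^esub> B \<subseteq> carrier G"
      using sub by (intro G.set_mult_closed) (auto dest: subgroup.subset)
    ultimately have "carrier G = C <#>\<^bsub>G\<^esub> B" ..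
    then interpret trivial_factorization G H C B
      using assms sub skew_brace_pair_axioms
      by (intro trivial_factorization.intro trivial_factorization_axioms.intro)
    show ?thesis by (rule derived_trivial)
  qed
qed

end
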